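(* For every $t\in\mathbb{C}\setminus\{0\}$, every $\mu\in\mathbb{R}$ and every integer $n\ge 0$, $$\left.\frac{\partial^{n}I_{\nu}(t)}{\partial\nu^{n}}\right|_{\nu=\mu}+(-1)^{n+1}\left.\frac{\partial^{n}I_{\nu}(t)}{\partial\nu^{n}}\right|_{\nu=-\mu}=-\frac{2}{\pi}\sin(\pi\mu)\sum_{k=0}^{\lfloor n/2\rfloor}\binom{n}{2k}(-\pi^{2})^{k}\frac{\partial^{n-2k}K_{\mu}(t)}{\partial\mu^{n-2k}}-2\cos(\pi\mu)\sum_{k=0}^{\lfloor (n-1)/2\rfloor}\binom{n}{2k+1}(-\pi^{2})^{k}\frac{\partial^{n-2k-1}K_{\mu}(t)}{\partial\mu^{n-2k-1}}.$$
   Context: $I_\nu(t)=\sum_{k=0}^{\infty}\frac{1}{k!\,\Gamma(k+\nu+1)}\left(\frac{t}{2}\right)^{2k+\nu}$ is the modified Bessel function of the first kind (principal branch, $-\pi<\arg t\le\pi$; $1/\Gamma$ is zero at the poles of $\Gamma$), and $K_\nu(t)=\frac{\pi}{2}\,\frac{I_{-\nu}(t)-I_\nu(t)}{\sin\pi\nu}$ (for integer $\nu$, the limit in $\nu$) is the modified Bessel function of the second kind. A zeroth derivative is the function itself, and empty sums are $0$. *)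

theory Defs
  imports "HOL-Complex_Analysis.Complex_Analysis"
begin

text \<open>
  \<open>rGamma\<close> is the entire function \<open>1/\<Gamma>\<close>, equal to zero at the poles of \<open>\<Gamma>\<close>. Complex \<open>powr\<close> uses
  the principal branch, with argument in \<open>(-\<pi>, \<pi>]\<close>. Its convention \<open>0 powr z = 0\<close> makes
  the value at \<open>t = 0\<close> unreliable for \<open>\<nu> = 0\<close>; only \<open>t \<noteq> 0\<close> is intended.
\<close>
definition bessel_I :: "complex \<Rightarrow> complex \<Rightarrow> complex" where
  "bessel_I \<nu> t =
     (\<Sum>k. 1 / fact k * rGamma (of_nat k + \<nu> + 1) * (t / 2) powr (2 * of_nat k + \<nu>))"

definition bessel_K_quotient :: "complex \<Rightarrow> complex \<Rightarrow> complex" where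
  "bessel_K_quotient \<nu> t =
     of_real pi / 2 * ((bessel_I (-\<nu>) t - bessel_I \<nu> t) / sin (of_real pi * \<nu>))"

definition bessel_K :: "complex \<Rightarrow> complex \<Rightarrow> complex" where
  "bessel_K \<nu> t =
     (if \<nu> \<in> \<int> then Lim (at \<nu>) (\<lambda>z. bessel_K_quotient z t) else bessel_K_quotient \<nu> t)"

end

theory Submission
  imports Defs
begin

text \<open>
  \<open>I\<^sub>\<nu>(t)\<close> is entire in \<open>\<nu>\<close>: once \<open>k\<close> is large, \<open>\<bar>1/\<Gamma>(k + \<nu> + 1)\<bar>\<close> decreases in \<open>k\<close>, so the
  series is locally dominated by an exponential series. The difference \<open>I\<^sub>-\<^sub>\<nu> - I\<^sub>\<nu>\<close> vanishes at
  the integers, which are the simple zeros of \<open>sin \<pi>\<nu>\<close>; hence \<open>K\<^sub>\<nu>\<close> is entire as well and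
  \<open>I\<^sub>\<nu> - I\<^sub>-\<^sub>\<nu> = -(2/\<pi>) sin (\<pi>\<nu>) K\<^sub>\<nu>\<close> holds for every \<open>\<nu>\<close>. The theorem is the \<open>n\<close>-th derivative
  of this identity by the Leibniz rule, with the terms of even and odd order separated.
\<close>

text \<open>The recurrence \<open>rGamma w = w * rGamma (w + 1)\<close> with
  \<open>norm w \<ge> 1\<close> for \<open>w = k + z\<close> makes the norm non-increasing in
  \<open>k\<close> from \<open>N\<close> on. One bound at \<open>N\<close> thus controls a whole
  tail of the Bessel series.\<close>

lemma norm_rGamma_add_nat_le:
  fixes z :: complex
  assumes "norm z + 1 \<le> real N" "N \<le> k"
  shows "norm (rGamma (of_nat k + z)) \<le> norm (rGamma (of_nat N + z))"
  using assms(2)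
proof (induction k rule: dec_induct)
  case (step k)
  let ?w = "of_nat k + z"
  have "1 \<le> norm ?w"
    using norm_diff_ineq[of "of_nat k" z] step.hyps assms(1) by simp
  then have "norm (rGamma (?w + 1)) \<le> norm ?w * norm (rGamma (?w + 1))"
    by (simp add: mult_le_cancel_right1)
  also have "\<dots> = norm (rGamma ?w)"
    by (simp only: norm_mult[symmetric] rGamma_plus1)
  finally show ?case
    using step.IH by (simp add: ac_simps)
qed simp

lemma powr_two_nat_add:
  fixes t :: complex
  assumes "t \<noteq> 0"
  shows "t powr (2 * of_nat k + \<nu>) = (t\<^sup>2) ^ k * t powr \<nu>"
proof -
  have "t powr (2 * of_nat k) = t ^ (2 * k)"
    using powr_nat'[of t "2 * k"] assms by simp
  then show ?thesis
    by (simp add: powr_add power_mult)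
qed

lemma holomorphic_bessel_I:
  assumes "t \<noteq> 0"
  shows "(\<lambda>\<nu>. bessel_I \<nu> t) holomorphic_on UNIV"
proof -
  define f where "f k \<nu> = 1 / fact k * rGamma (of_nat k + \<nu> + 1) * (t / 2) powr (2 * of_nat k + \<nu>)"
    for k :: nat and \<nu> :: complex
  have f_eq: "f k \<nu> = (((t / 2)\<^sup>2) ^ k / fact k) * (rGamma (of_nat k + (\<nu> + 1)) * (t / 2) powr \<nu>)"
    for k \<nu> using assms unfolding f_def by (subst powr_two_nat_add) (simp_all add: add_ac)
  have f_hol: "f k holomorphic_on A" for k A
    unfolding f_def using assms by (intro holomorphic_intros) auto
  have "uniform_limit (cball x 1) (\<lambda>n \<nu>. \<Sum>k<n. f k \<nu>) (\<lambda>\<nu>. \<Sum>k. f k \<nu>) sequentially" for x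
  proof -
    \<comment> \<open>The 3 adds up the radius of the disc, the shift in \<open>\<nu> + 1\<close>,
      and the 1 demanded by \<open>norm_rGamma_add_nat_le\<close>.\<close>
    obtain N :: nat where N: "norm x + 3 \<le> real N"
      using real_arch_simple by blast
    define g where "g \<nu> = rGamma (of_nat N + (\<nu> + 1)) * (t / 2) powr \<nu>" for \<nu>
    have "g holomorphic_on cball x 1"
      unfolding g_def by (intro holomorphic_intros)
    \<comment> \<open>Compactness bounds the single factor at \<open>k = N\<close>; the same
      \<open>C\<close> then serves for every larger \<open>k\<close>.\<close>
    then have "bounded (g ` cball x 1)"
      by (intro compact_imp_bounded compact_continuous_image holomorphic_on_imp_continuous_on) auto
    then obtain C where C: "\<And>\<nu>. \<nu> \<in> cball x 1 \<Longrightarrow> norm (g \<nu>) \<le> C"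
      unfolding bounded_iff by blast
    have "norm (f k \<nu>) \<le> norm ((t / 2)\<^sup>2) ^ k / fact k * C" if "N \<le> k" "\<nu> \<in> cball x 1" for k \<nu>
    proof -
      have "norm \<nu> \<le> norm x + 1"
        using that(2) norm_triangle_sub[of \<nu> x] by (simp add: dist_norm norm_minus_commute)
      then have "norm (\<nu> + 1) + 1 \<le> real N"
        using N norm_triangle_ineq[of \<nu> 1] by simp
      then have "norm (rGamma (of_nat k + (\<nu> + 1)) * (t / 2) powr \<nu>) \<le> norm (g \<nu>)"
        unfolding g_def norm_mult
        by (intro mult_right_mono norm_rGamma_add_nat_le that(1)) auto
      also have "\<dots> \<le> C"
        using C that(2) by blast
      finally show ?thesis
        unfolding f_eq norm_mult[of "_ / _"]
        by (intro mult_mono) (simp_all add: norm_divide norm_power norm_mult)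
    qed
    then have "\<forall>\<^sub>F k in sequentially. \<forall>\<nu>\<in>cball x 1. norm (f k \<nu>) \<le> norm ((t / 2)\<^sup>2) ^ k / fact k * C"
      unfolding eventually_sequentially by blast
    moreover have "summable (\<lambda>k. norm ((t / 2)\<^sup>2) ^ k / fact k * C)"
      using summable_exp[of "norm ((t / 2)\<^sup>2)"]
      by (intro summable_mult2) (simp add: field_simps)
    ultimately show ?thesis
      by (rule Weierstrass_m_test_ev)
  qed
  then have "\<exists>d>0. cball x d \<subseteq> UNIV \<and>
      uniform_limit (cball x d) (\<lambda>n \<nu>. \<Sum>k<n. f k \<nu>) (\<lambda>\<nu>. \<Sum>k. f k \<nu>) sequentially" for x
    by (intro exI[of _ 1]) simp
  then have "(\<lambda>\<nu>. \<Sum>k. f k \<nu>) holomorphic_on UNIV"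
    by (rule holomorphic_uniform_sequence[OF open_UNIV holomorphic_on_sum[OF f_hol]])
  then show ?thesis
    by (simp add: bessel_I_def f_def)
qed

text \<open>At order \<open>- m\<close> the first \<open>m\<close> terms sit at poles of Gamma and
  vanish. Shifting the rest by \<open>m\<close> swaps the roles of \<open>1 / k!\<close> and
  \<open>1 / (k + m)!\<close>.\<close>

lemma bessel_I_minus_nat: "bessel_I (- of_nat m) t = bessel_I (of_nat m) t"
proof -
  let ?f = "\<lambda>\<nu> k. 1 / fact k * rGamma (of_nat k + \<nu> + 1) * (t / 2) powr (2 * of_nat k + \<nu>)"
  have vanish: "?f (- of_nat m) k = 0" if "k < m" for k
  proof -
    have "of_nat k + - of_nat m + 1 = (- of_nat (m - Suc k) :: complex)"
      using that by (auto simp: less_iff_Suc_add)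
    then have "rGamma (of_nat k + - of_nat m + 1) = (0::complex)"
      by (simp add: rGamma_eq_zero_iff)
    then show ?thesis by simp
  qed
  have shift: "?f (- of_nat m) (k + m) = ?f (of_nat m) k" for k
  proof -
    have "rGamma (of_nat (k + m) + - of_nat m + 1) = (1 / fact k :: complex)"
      using Gamma_fact[of k, where 'a = complex] by (simp add: rGamma_inverse_Gamma field_simps)
    moreover have "rGamma (of_nat k + of_nat m + 1) = (1 / fact (k + m) :: complex)"
      using Gamma_fact[of "k + m", where 'a = complex] by (simp add: rGamma_inverse_Gamma field_simps)
    moreover have "2 * of_nat (k + m) + - of_nat m = (2 * of_nat k + of_nat m :: complex)"
      by simp
    ultimately show ?thesis
      by (simp only:) simp
  qed
  \<comment> \<open>Having this for every \<open>s\<close> makes the two \<open>suminf\<close> the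
    same description.\<close>
  have "?f (- of_nat m) sums s \<longleftrightarrow> ?f (of_nat m) sums s" for s
    using sums_zero_iff_shift[of m "?f (- of_nat m)" s] vanish by (simp only: shift)
  then show ?thesis
    by (simp only: bessel_I_def suminf_def)
qed

lemma bessel_I_minus_Ints:
  assumes "\<nu> \<in> \<int>"
  shows "bessel_I (- \<nu>) t = bessel_I \<nu> t"
proof -
  obtain i where "\<nu> = of_int i"
    using assms by (elim Ints_cases)
  then show ?thesis
    using bessel_I_minus_nat[of "nat \<bar>i\<bar>"] by (cases "i \<ge> 0") simp_all
qed

lemma sin_pi_times_eq_0_iff: "sin (of_real pi * z) = 0 \<longleftrightarrow> z \<in> \<int>" for z :: complex
  by (auto simp: sin_eq_0 Ints_def mult.commute)

text \<open>Distinct integers are at distance at least 1, so the integers other than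
  \<open>z\<close> form a closed set.\<close>

lemma eventually_at_not_Ints: "\<forall>\<^sub>F w in at z. w \<notin> \<int>" for z :: complex
proof -
  have "open (- (\<int> - {z}))"
    by (intro open_Compl discrete_imp_closed[of 1])
       (auto elim!: Ints_cases simp: dist_of_int simp flip: of_int_diff)
  then show ?thesis
    unfolding eventually_at_topological by blast
qed

text \<open>Off the integers this is a quotient with nonzero denominator. At an integer, L'Hopital's
  rule gives continuity, and an isolated singularity where the function is continuous is
  removable.\<close>

lemma holomorphic_bessel_K:
  assumes "t \<noteq> 0"
  shows "(\<lambda>\<nu>. bessel_K \<nu> t) holomorphic_on UNIV"
proof -
  note hol_I = holomorphic_bessel_I[OF assms]
  have hol_I_minus: "(\<lambda>\<nu>. bessel_I (- \<nu>) t) holomorphic_on A" for A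
    using holomorphic_on_compose_gen[OF _ hol_I, of uminus A]
    by (simp add: o_def holomorphic_intros)
  have hol_Q: "(\<lambda>\<nu>. bessel_K_quotient \<nu> t) holomorphic_on - \<int>"
    unfolding bessel_K_quotient_def
    by (intro holomorphic_intros hol_I_minus holomorphic_on_subset[OF hol_I])
       (auto simp: sin_pi_times_eq_0_iff)
  have hol_compl: "(\<lambda>\<nu>. bessel_K \<nu> t) holomorphic_on - \<int>"
    by (rule holomorphic_transform[OF hol_Q]) (simp add: bessel_K_def)
  have "isCont (\<lambda>\<nu>. bessel_K \<nu> t) z" if "z \<in> \<int>" for z
  proof -
    let ?D = "\<lambda>\<nu>. bessel_I (- \<nu>) t - bessel_I \<nu> t"
    have "?D holomorphic_on UNIV"
      by (intro holomorphic_intros hol_I hol_I_minus)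
    then obtain D' where D': "(?D has_field_derivative D') (at z)"
      unfolding holomorphic_on_def field_differentiable_def by auto
    have sin': "((\<lambda>\<nu>. sin (of_real pi * \<nu>)) has_field_derivative of_real pi * cos (of_real pi * z)) (at z)"
      by (auto intro!: derivative_eq_intros)
    have sin_z: "sin (of_real pi * z) = 0"
      using that by (simp add: sin_pi_times_eq_0_iff)
    then have "cos (of_real pi * z) \<noteq> 0"
      using sin_cos_squared_add[of "of_real pi * z"] by auto
    then have "((\<lambda>\<nu>. ?D \<nu> / sin (of_real pi * \<nu>)) \<longlongrightarrow> D' / (of_real pi * cos (of_real pi * z))) (at z)"
      using sin_z bessel_I_minus_Ints[OF that]
      by (intro lhopital_complex_simple[OF D' sin']) auto
    \<comment> \<open>Only once a limit exists is the \<open>Lim\<close> in \<open>bessel_K\<close>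
      known to be that limit.\<close>
    then have "\<exists>l. ((\<lambda>\<nu>. bessel_K_quotient \<nu> t) \<longlongrightarrow> l) (at z)"
      unfolding bessel_K_quotient_def by - (rule exI, erule tendsto_mult_left)
    then have "((\<lambda>\<nu>. bessel_K_quotient \<nu> t) \<longlongrightarrow> bessel_K z t) (at z)"
      using that by (auto simp: bessel_K_def tendsto_Lim)
    moreover have "\<forall>\<^sub>F \<nu> in at z. bessel_K_quotient \<nu> t = bessel_K \<nu> t"
      using eventually_at_not_Ints by eventually_elim (simp add: bessel_K_def)
    ultimately show ?thesis
      unfolding isCont_def by (rule Lim_transform_eventually)
  qed
  moreover have "open (- \<int> :: complex set)"
    by (simp add: open_Compl)
  ultimately have cont: "isCont (\<lambda>\<nu>. bessel_K \<nu> t) z" for z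
    using holomorphic_on_imp_continuous_on[OF hol_compl]
    by (cases "z \<in> \<int>") (auto simp: continuous_on_eq_continuous_at)
  have "\<exists>e>0. (\<lambda>\<nu>. bessel_K \<nu> t) holomorphic_on ball z e" for z
  proof -
    obtain e where e: "e > 0" "\<And>w. w \<in> ball z e \<Longrightarrow> w \<noteq> z \<Longrightarrow> w \<notin> \<int>"
      using eventually_at_not_Ints[of z] unfolding eventually_at by (auto simp: dist_commute)
    have "(\<lambda>\<nu>. bessel_K \<nu> t) holomorphic_on ball z e"
    proof (rule no_isolated_singularity[where K = "{z}"])
      show "continuous_on (ball z e) (\<lambda>\<nu>. bessel_K \<nu> t)"
        using cont by (simp add: continuous_at_imp_continuous_on)
      show "(\<lambda>\<nu>. bessel_K \<nu> t) holomorphic_on ball z e - {z}"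
        using e by (intro holomorphic_on_subset[OF hol_compl]) auto
    qed auto
    with e show ?thesis by blast
  qed
  then have "(\<lambda>\<nu>. bessel_K \<nu> t) analytic_on UNIV"
    by (simp add: analytic_on_def)
  then show ?thesis
    by (rule analytic_imp_holomorphic)
qed

text \<open>At integers both sides are zero, whatever value \<open>bessel_K\<close> takes; elsewhere
  this is its definition solved for the difference.\<close>

lemma bessel_I_diff_eq_sin_bessel_K:
  "bessel_I \<nu> t - bessel_I (- \<nu>) t = - (2 / of_real pi) * (sin (of_real pi * \<nu>) * bessel_K \<nu> t)"
proof (cases "\<nu> \<in> \<int>")
  case True
  then show ?thesis
    using bessel_I_minus_Ints[OF True] by (simp add: sin_pi_times_eq_0_iff)
next
  case False
  then have "sin (of_real pi * \<nu>) \<noteq> 0"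
    by (simp add: sin_pi_times_eq_0_iff)
  with False show ?thesis
    by (simp add: bessel_K_def bessel_K_quotient_def)
qed

lemma higher_deriv_sin_linear:
  fixes c :: complex
  shows "(deriv ^^ (2 * k)) (\<lambda>z. sin (c * z)) = (\<lambda>z. (- c\<^sup>2) ^ k * sin (c * z))"
    and "(deriv ^^ (2 * k + 1)) (\<lambda>z. sin (c * z)) = (\<lambda>z. c * (- c\<^sup>2) ^ k * cos (c * z))"
proof -
  have d_sin: "deriv (\<lambda>z. a * sin (c * z)) = (\<lambda>z. c * a * cos (c * z))" for a
    by (rule ext, rule DERIV_imp_deriv) (auto intro!: derivative_eq_intros)
  have d_cos: "deriv (\<lambda>z. a * cos (c * z)) = (\<lambda>z. - c * a * sin (c * z))" for a
    by (rule ext, rule DERIV_imp_deriv) (auto intro!: derivative_eq_intros)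
  \<comment> \<open>Two derivatives contribute the factor \<open>- c\<^sup>2\<close>; one more turns
    this into the odd case.\<close>
  show even: "(deriv ^^ (2 * k)) (\<lambda>z. sin (c * z)) = (\<lambda>z. (- c\<^sup>2) ^ k * sin (c * z))" for k
  proof (induction k)
    case (Suc k)
    have "(deriv ^^ (2 * Suc k)) (\<lambda>z. sin (c * z)) = deriv (deriv (\<lambda>z. (- c\<^sup>2) ^ k * sin (c * z)))"
      by (simp only: mult_Suc_right add_2_eq_Suc funpow.simps o_apply Suc.IH)
    also have "\<dots> = (\<lambda>z. (- c\<^sup>2) ^ Suc k * sin (c * z))"
      unfolding d_sin d_cos by (simp add: power2_eq_square mult_ac)
    finally show ?case .
  qed simp
  show "(deriv ^^ (2 * k + 1)) (\<lambda>z. sin (c * z)) = (\<lambda>z. c * (- c\<^sup>2) ^ k * cos (c * z))"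
    by (simp only: Suc_eq_plus1[symmetric] funpow.simps o_apply even d_sin)
qed

text \<open>The odd indices are cut off by \<open>2 * k + 1 \<le> n\<close> because
  \<open>(n - 1) div 2\<close> on naturals would wrongly admit \<open>k = 0\<close> when
  \<open>n = 0\<close>.\<close>

lemma sum_even_odd_split:
  fixes f :: "nat \<Rightarrow> 'a::comm_monoid_add"
  shows "(\<Sum>i = 0..n. f i) = (\<Sum>k = 0..n div 2. f (2 * k)) + (\<Sum>k | 2 * k + 1 \<le> n. f (2 * k + 1))"
proof -
  have "{0..n} = (\<lambda>k. 2 * k) ` {0..n div 2} \<union> (\<lambda>k. 2 * k + 1) ` {k. 2 * k + 1 \<le> n}" (is "_ = ?E \<union> ?O")
  proof (intro equalityI subsetI)
    fix i assume "i \<in> {0..n}"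
    then show "i \<in> ?E \<union> ?O"
      by (cases "even i") (auto elim!: evenE oddE)
  qed auto
  moreover have "finite {k. 2 * k + 1 \<le> n}"
    by (rule finite_subset[of _ "{..n}"]) auto
  moreover have "?E \<inter> ?O = {}"
    by (auto, presburger)
  ultimately have "(\<Sum>i = 0..n. f i) = sum f ?E + sum f ?O"
    by (simp only:) (subst sum.union_disjoint; simp)
  then show ?thesis
    by (simp add: sum.reindex inj_on_def)
qed

theorem theorem3p9:
  fixes t :: complex and \<mu> :: real and n :: nat
  assumes "t \<noteq> 0"
  shows "(deriv ^^ n) (\<lambda>\<nu>. bessel_I \<nu> t) (of_real \<mu>)
           + (-1) ^ (n + 1) * (deriv ^^ n) (\<lambda>\<nu>. bessel_I \<nu> t) (- of_real \<mu>)
       = - (2 / of_real pi) * of_real (sin (pi * \<mu>)) *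
           (\<Sum>k = 0..n div 2. of_nat (n choose (2 * k)) * (- (of_real pi)\<^sup>2) ^ k *
              (deriv ^^ (n - 2 * k)) (\<lambda>\<nu>. bessel_K \<nu> t) (of_real \<mu>))
         - 2 * of_real (cos (pi * \<mu>)) *
           (\<Sum>k \<in> {k. int k \<le> \<lfloor>(real n - 1) / 2\<rfloor>}. of_nat (n choose (2 * k + 1)) * (- (of_real pi)\<^sup>2) ^ k *
              (deriv ^^ (n - 2 * k - 1)) (\<lambda>\<nu>. bessel_K \<nu> t) (of_real \<mu>))"
proof -
  let ?I = "\<lambda>\<nu>. bessel_I \<nu> t" and ?K = "\<lambda>\<nu>. bessel_K \<nu> t"
  let ?S = "\<lambda>\<nu>::complex. sin (of_real pi * \<nu>)" and ?m = "complex_of_real \<mu>"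
  note hol_I = holomorphic_bessel_I[OF assms] and hol_K = holomorphic_bessel_K[OF assms]
  have hol_I_minus: "(\<lambda>\<nu>. ?I (- 1 * \<nu>)) holomorphic_on UNIV"
    using holomorphic_on_compose_gen[OF _ hol_I, of "\<lambda>\<nu>. - 1 * \<nu>" UNIV]
    by (simp add: o_def holomorphic_intros)
  have hol_S: "?S holomorphic_on UNIV"
    by (intro holomorphic_intros)
  \<comment> \<open>For \<open>n = 0\<close> the floor is \<open>-1\<close>, so the odd sum is
    empty.\<close>
  have floor_iff: "int k \<le> \<lfloor>(real n - 1) / 2\<rfloor> \<longleftrightarrow> 2 * k + 1 \<le> n" for k
    by (simp add: le_floor_iff) linarith
  have sin_m: "?S ?m = of_real (sin (pi * \<mu>))" and cos_m: "cos (of_real pi * ?m) = of_real (cos (pi * \<mu>))"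
    by (simp_all flip: of_real_mult add: sin_of_real cos_of_real)
  let ?T = "\<lambda>i. of_nat (n choose i) * (deriv ^^ i) ?S ?m * (deriv ^^ (n - i)) ?K ?m"
  \<comment> \<open>The chain rule for the inner factor \<open>- 1\<close> yields
    \<open>(-1) ^ n\<close>; the minus sign of the difference supplies the extra sign.\<close>
  have "(deriv ^^ n) ?I ?m + (-1) ^ (n + 1) * (deriv ^^ n) ?I (- ?m)
      = (deriv ^^ n) (\<lambda>\<nu>. ?I \<nu> - ?I (- 1 * \<nu>)) ?m"
    by (subst higher_deriv_diff[OF hol_I hol_I_minus])
       (simp_all add: higher_deriv_compose_linear[OF hol_I, where S = UNIV and u = "- 1", simplified])
  also have "\<dots> = (deriv ^^ n) (\<lambda>\<nu>. - (2 / of_real pi) * (?S \<nu> * ?K \<nu>)) ?m"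
    by (simp add: bessel_I_diff_eq_sin_bessel_K)
  also have "\<dots> = - (2 / of_real pi) * (deriv ^^ n) (\<lambda>\<nu>. ?S \<nu> * ?K \<nu>) ?m"
    by (rule higher_deriv_cmult[where A = UNIV]) (auto intro!: holomorphic_intros hol_K)
  also have "\<dots> = - (2 / of_real pi) * (\<Sum>i = 0..n. ?T i)"
    by (simp add: higher_deriv_mult[OF hol_S hol_K])
  also have "(\<Sum>i = 0..n. ?T i) = (\<Sum>k = 0..n div 2. ?T (2 * k)) + (\<Sum>k | 2 * k + 1 \<le> n. ?T (2 * k + 1))"
    by (rule sum_even_odd_split)
  also have "(\<Sum>k = 0..n div 2. ?T (2 * k)) = of_real (sin (pi * \<mu>)) *
      (\<Sum>k = 0..n div 2. of_nat (n choose (2 * k)) * (- (of_real pi)\<^sup>2) ^ k * (deriv ^^ (n - 2 * k)) ?K ?m)"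
    unfolding sum_distrib_left higher_deriv_sin_linear sin_m by (simp add: mult_ac)
  \<comment> \<open>The odd derivatives of the sine carry one extra factor \<open>pi\<close>, which
    cancels the one in \<open>2 / pi\<close> and leaves the coefficient 2 of the cosine.\<close>
  also have "(\<Sum>k | 2 * k + 1 \<le> n. ?T (2 * k + 1)) = of_real pi * of_real (cos (pi * \<mu>)) *
      (\<Sum>k | 2 * k + 1 \<le> n. of_nat (n choose (2 * k + 1)) * (- (of_real pi)\<^sup>2) ^ k * (deriv ^^ (n - 2 * k - 1)) ?K ?m)"
    unfolding sum_distrib_left higher_deriv_sin_linear cos_m by (simp add: mult_ac)
  finally show ?thesis
    unfolding floor_iff by (simp add: ring_distribs)
qed

end
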